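(* Let $j,k,\ell$ be integers with $1\le k\le j\le \ell$. If $j$ is odd, then the set $D_{\ell,j,k}$ is a $(4^{2\ell},\ (4^{\ell}+1)(4^{\ell-1}-1),\ 4^{2\ell-2}-3\cdot 4^{\ell-1}-2,\ 4^{2\ell-2}-4^{\ell-1})$-partial difference set in the additive group of $(\mathrm{GR}(4,2))^k\times\mathbb F_4^{2\ell-2k}\cong \mathbb Z_4^{2k}\times\mathbb Z_2^{4\ell-4k}$. If $j$ is even, then $D_{\ell,j,k}$ is a $(4^{2\ell},\ (4^{\ell}-1)(4^{\ell-1}+1),\ 4^{2\ell-2}+3\cdot 4^{\ell-1}-2,\ 4^{2\ell-2}+4^{\ell-1})$-partial difference set in the same group.
   Context: A $\kappa$-element subset $D$ of a finite (multiplicatively written) group $G$ of order $v$ is a $(v,\kappa,\lambda,\mu)$-partial difference set (PDS) in $G$ if the multiset $\{d_1d_2^{-1}\mid d_1,d_2\in D,\ d_1\ne d_2\}$ contains each nonidentity element of $D$ exactly $\lambda$ times and each nonidentity element of $G\setminus D$ exactly $\mu$ times. Let $\mathbb F_4=\{0,1,\alpha,\alpha^2=\alpha+1\}$. For integers $\ell\ge1$, $0\le j\le\ell$, define the quadratic form on $\mathbb F_4^{2\ell}$ $$Q_{\ell,j}(x_1,\dots,x_{2\ell})=\sum_{i=1}^{j}(\alpha x_{2i-1}^2+x_{2i-1}x_{2i}+x_{2i}^2)+\sum_{i=j+1}^{\ell}x_{2i-1}x_{2i}.$$ Let $R=\mathrm{GR}(4,2)=\mathbb Z_4[x]/\langle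 x^2+x+1\rangle$, let $\xi$ be the image of $x$, and $\mathcal T=\{0,1,\xi,\xi^2\}$ (the Teichmüller system). Let $\pi:R\to R/2R\cong\mathbb F_4$ be the natural epimorphism; it restricts to a bijection $\mathcal T\to\mathbb F_4$, and $\pi^{-1}:\mathbb F_4\to\mathcal T$ denotes the inverse of that bijection. Every element of $R$ is uniquely $\beta_1+2\beta_2$ with $\beta_1,\beta_2\in\mathcal T$. For $0\le k\le\ell$ let $F_k:\mathbb F_4^{2\ell}\to R^k\times\mathbb F_4^{2\ell-2k}$ be the bijection $$F_k(x_1,\dots,x_{2\ell})=(\pi^{-1}(x_1)+2\pi^{-1}(x_2),\dots,\pi^{-1}(x_{2k-1})+2\pi^{-1}(x_{2k}),x_{2k+1},\dots,x_{2\ell}).$$ For $0\le k\le j\le\ell$, $\ell\ge1$, define $$D_{\ell,j,k}=\{F_k(x_1,\dots,x_{2\ell})\mid (x_1,\dots,x_{2\ell})\in\mathbb F_4^{2\ell}\setminus\{0\},\ Q_{\ell,j}(x_1,\dots,x_{2\ell})=0\}.$$ *)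

theory Defs
  imports
    "HOL-Algebra.Product_Groups"
    "HOL-Library.Multiset"
    "HOL-Library.Numeral_Type"
    "HOL-Computational_Algebra.Polynomial"
begin

section \<open>Partial difference sets\<close>

text \<open>
  The parameters are integers: \<open>lam\<close> may be negative when \<open>D\<close> has no nonidentity element
  (e.g. \<open>D = {}\<close>), in which case the condition on \<open>lam\<close> is vacuous.
\<close>

definition difference_multiset :: "('a, 'b) monoid_scheme \<Rightarrow> 'a set \<Rightarrow> 'a multiset" where
  "difference_multiset G D =
    image_mset (\<lambda>(d1, d2). d1 \<otimes>\<^bsub>G\<^esub> inv\<^bsub>G\<^esub> d2) (mset_set {(d1, d2). d1 \<in> D \<and> d2 \<in> D \<and> d1 \<noteq> d2})"

definition partial_difference_set ::
  "('a, 'b) monoid_scheme \<Rightarrow> int \<Rightarrow> int \<Rightarrow> int \<Rightarrow> int \<Rightarrow> 'a set \<Rightarrow> bool" where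
  "partial_difference_set G v \<kappa> lam mu D \<longleftrightarrow>
     group G \<and> finite (carrier G) \<and> int (Coset.order G) = v \<and>
     D \<subseteq> carrier G \<and> int (card D) = \<kappa> \<and>
     (\<forall>g \<in> D - {\<one>\<^bsub>G\<^esub>}. int (count (difference_multiset G D) g) = lam) \<and>
     (\<forall>g \<in> (carrier G - D) - {\<one>\<^bsub>G\<^esub>}. int (count (difference_multiset G D) g) = mu)"

definition additive_group :: "'a::ab_group_add monoid" where
  "additive_group = \<lparr>carrier = UNIV, monoid.mult = (+), one = 0\<rparr>"

lemma group_additive_group: "group (additive_group :: 'a::ab_group_add monoid)"
  unfolding additive_group_def
  by (rule groupI) (auto simp: add.assoc intro: exI[of _ "- x" for x])


section \<open>The field with four elements\<close>

datatype F4 = F4_0 | F4_1 | F4_alpha (\<open>\<alpha>\<close>) | F4_alpha2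

instantiation F4 :: field
begin

definition zero_F4 :: F4 where "zero_F4 = F4_0"

definition one_F4 :: F4 where "one_F4 = F4_1"

fun plus_F4 :: "F4 \<Rightarrow> F4 \<Rightarrow> F4" where
  "plus_F4 F4_0 y = y"
| "plus_F4 x F4_0 = x"
| "plus_F4 F4_1 F4_1 = F4_0"
| "plus_F4 F4_1 F4_alpha = F4_alpha2"
| "plus_F4 F4_1 F4_alpha2 = F4_alpha"
| "plus_F4 F4_alpha F4_1 = F4_alpha2"
| "plus_F4 F4_alpha F4_alpha = F4_0"
| "plus_F4 F4_alpha F4_alpha2 = F4_1"
| "plus_F4 F4_alpha2 F4_1 = F4_alpha"
| "plus_F4 F4_alpha2 F4_alpha = F4_1"
| "plus_F4 F4_alpha2 F4_alpha2 = F4_0"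

fun times_F4 :: "F4 \<Rightarrow> F4 \<Rightarrow> F4" where
  "times_F4 F4_0 y = F4_0"
| "times_F4 x F4_0 = F4_0"
| "times_F4 F4_1 y = y"
| "times_F4 x F4_1 = x"
| "times_F4 F4_alpha F4_alpha = F4_alpha2"
| "times_F4 F4_alpha F4_alpha2 = F4_1"
| "times_F4 F4_alpha2 F4_alpha = F4_1"
| "times_F4 F4_alpha2 F4_alpha2 = F4_alpha"

definition uminus_F4 :: "F4 \<Rightarrow> F4" where "uminus_F4 x = x"

definition minus_F4 :: "F4 \<Rightarrow> F4 \<Rightarrow> F4" where "minus_F4 x y = x + y"

fun inverse_F4 :: "F4 \<Rightarrow> F4" where
  "inverse_F4 F4_0 = F4_0"
| "inverse_F4 F4_1 = F4_1"
| "inverse_F4 F4_alpha = F4_alpha2"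
| "inverse_F4 F4_alpha2 = F4_alpha"

definition divide_F4 :: "F4 \<Rightarrow> F4 \<Rightarrow> F4" where "divide_F4 x y = x * inverse y"

instance
proof
  fix a b c :: F4
  show "a * b * c = a * (b * c)" by (cases a; cases b; cases c) simp_all
  show "a * b = b * a" by (cases a; cases b) simp_all
  show "1 * a = a" by (cases a) (simp_all add: one_F4_def)
  show "a + b + c = a + (b + c)" by (cases a; cases b; cases c) simp_all
  show "a + b = b + a" by (cases a; cases b) simp_all
  show "0 + a = a" by (cases a) (simp_all add: zero_F4_def)
  show "- a + a = 0" by (cases a) (simp_all add: zero_F4_def uminus_F4_def)
  show "a - b = a + - b" by (simp add: minus_F4_def uminus_F4_def)
  show "(a + b) * c = a * c + b * c" by (cases a; cases b; cases c) simp_all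
  show "(0::F4) \<noteq> 1" by (simp add: zero_F4_def one_F4_def)
  show "inverse a * a = 1" if "a \<noteq> 0"
    using that by (cases a) (simp_all add: zero_F4_def one_F4_def)
  show "a div b = a * inverse b" by (simp add: divide_F4_def)
  show "inverse (0::F4) = 0" by (simp add: zero_F4_def)
qed

end

lemma UNIV_F4: "(UNIV :: F4 set) = {0, 1, \<alpha>, \<alpha>\<^sup>2}"
proof -
  have "x \<in> {0, 1, \<alpha>, \<alpha>\<^sup>2}" for x :: F4
    by (cases x) (simp_all add: zero_F4_def one_F4_def power2_eq_square)
  then show ?thesis by blast
qed

lemma alpha_square: "\<alpha>\<^sup>2 = \<alpha> + 1"
  by (simp add: power2_eq_square one_F4_def)

lemma double_F4: "x + x = (0 :: F4)"
  by (cases x) (simp_all add: zero_F4_def)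

instance F4 :: finite
  by standard (simp add: UNIV_F4)

lemma CARD_F4: "CARD(F4) = 4"
  by (simp add: UNIV_F4 zero_F4_def one_F4_def power2_eq_square)


section \<open>The Galois ring \<open>\<int>\<^sub>4[x]/\<langle>x\<^sup>2 + x + 1\<rangle>\<close>\<close>

text \<open>The numeral type \<^typ>\<open>4\<close> is the ring of integers modulo 4.\<close>

quotient_type GR42 = "4 poly" / "\<lambda>p q. [:1, 1, 1:] dvd p - q"
proof (rule equivpI)
  show "reflp (\<lambda>p q :: 4 poly. [:1, 1, 1:] dvd p - q)"
    by (simp add: reflp_def)
  show "symp (\<lambda>p q :: 4 poly. [:1, 1, 1:] dvd p - q)"
    by (metis (no_types, lifting) minus_diff_eq dvd_minus_iff sympI)
  show "transp (\<lambda>p q :: 4 poly. [:1, 1, 1:] dvd p - q)"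
  proof (rule transpI)
    fix p q r :: "4 poly"
    assume "[:1, 1, 1:] dvd p - q" "[:1, 1, 1:] dvd q - r"
    then have "[:1, 1, 1:] dvd (p - q) + (q - r)" by (rule dvd_add)
    then show "[:1, 1, 1:] dvd p - r" by simp
  qed
qed

text \<open>
  Evaluation of a polynomial over \<open>\<int>\<^sub>4\<close> at \<open>\<alpha>\<close>, its coefficients being reduced
  modulo 2; this induces the natural epimorphism of the Galois ring onto its residue field.
\<close>

definition eval_alpha :: "4 poly \<Rightarrow> F4" where
  "eval_alpha p = poly (map_poly (\<lambda>c. of_int (Rep_bit0 c)) p) \<alpha>"

lemma of_int_F4: "(of_int n :: F4) = (if even n then 0 else 1)"
proof -
  have "(of_int (2 * m) :: F4) = 0" for m
    by (simp only: mult_2 of_int_add double_F4)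
  then show ?thesis
    by (auto elim!: evenE oddE)
qed

lemma Rep_4_simps:
  "Rep_bit0 (0 :: 4) = 0" "Rep_bit0 (1 :: 4) = 1"
  "even (Rep_bit0 (a + b :: 4)) = even (Rep_bit0 a + Rep_bit0 b)"
  "even (Rep_bit0 (a * b :: 4)) = even (Rep_bit0 a * Rep_bit0 b)"
proof -
  have "Rep_bit0 (Abs_bit0 (n mod 4) :: 4) = n mod 4" for n
    using bit0.Rep_Abs_mod[where 'a = 2, of n] by simp
  then show "even (Rep_bit0 (a + b)) = even (Rep_bit0 a + Rep_bit0 b)"
    and "even (Rep_bit0 (a * b)) = even (Rep_bit0 a * Rep_bit0 b)"
    by (simp_all add: bit0.add_def bit0.mult_def dvd_mod_iff)
qed (simp_all add: bit0.Rep_0 bit0.Rep_1)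

lemma eval_alpha_0 [simp]: "eval_alpha 0 = 0"
  by (simp add: eval_alpha_def)

lemma eval_alpha_pCons [simp]:
  "eval_alpha (pCons a p) = of_int (Rep_bit0 a) + \<alpha> * eval_alpha p"
  by (simp add: eval_alpha_def map_poly_pCons Rep_4_simps)

lemma eval_alpha_add: "eval_alpha (p + q) = eval_alpha p + eval_alpha q"
proof (induction p q rule: poly_induct2)
  case (pCons a p b q)
  have "(of_int (Rep_bit0 (a + b)) :: F4) = of_int (Rep_bit0 a) + of_int (Rep_bit0 b)"
    by (simp add: of_int_F4 Rep_4_simps double_F4)
  with pCons show ?case by (simp add: algebra_simps)
qed simp

lemma eval_alpha_smult: "eval_alpha (smult a q) = of_int (Rep_bit0 a) * eval_alpha q"
proof (induction q)
  case (pCons b q)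
  have "(of_int (Rep_bit0 (a * b)) :: F4) = of_int (Rep_bit0 a) * of_int (Rep_bit0 b)"
    by (simp add: of_int_F4 Rep_4_simps)
  with pCons show ?case by (simp add: algebra_simps)
qed simp

lemma eval_alpha_mult: "eval_alpha (p * q) = eval_alpha p * eval_alpha q"
  by (induction p) (simp_all add: eval_alpha_add eval_alpha_smult algebra_simps Rep_4_simps)

lemma eval_alpha_1: "eval_alpha 1 = 1"
  by (simp add: one_pCons Rep_4_simps)

lemma eval_alpha_modulus: "eval_alpha [:1, 1, 1:] = 0"
  by (simp add: Rep_4_simps zero_F4_def one_F4_def)

lemma eval_alpha_cong:
  assumes "[:1, 1, 1:] dvd p - q"
  shows "eval_alpha p = eval_alpha q"
proof -
  obtain r where "p - q = [:1, 1, 1:] * r" using assms by (rule dvdE)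
  then have "p = q + [:1, 1, 1:] * r" by (simp add: algebra_simps)
  then show ?thesis
    by (simp only: eval_alpha_add eval_alpha_mult eval_alpha_modulus) simp
qed

instantiation GR42 :: comm_ring_1
begin

lift_definition zero_GR42 :: GR42 is 0 .

lift_definition one_GR42 :: GR42 is 1 .

lift_definition plus_GR42 :: "GR42 \<Rightarrow> GR42 \<Rightarrow> GR42" is "(+)"
  by (metis add_diff_add dvd_add)

lift_definition uminus_GR42 :: "GR42 \<Rightarrow> GR42" is uminus
  by (metis minus_diff_minus dvd_minus_iff)

lift_definition minus_GR42 :: "GR42 \<Rightarrow> GR42 \<Rightarrow> GR42" is "(-)"
proof -
  fix p p' q q' :: "4 poly"
  assume "[:1, 1, 1:] dvd p - p'" "[:1, 1, 1:] dvd q - q'"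
  then have "[:1, 1, 1:] dvd (p - p') - (q - q')" by (rule dvd_diff)
  then show "[:1, 1, 1:] dvd p - q - (p' - q')" by (simp add: algebra_simps)
qed

lift_definition times_GR42 :: "GR42 \<Rightarrow> GR42 \<Rightarrow> GR42" is "(*)"
proof -
  fix p p' q q' :: "4 poly"
  assume "[:1, 1, 1:] dvd p - p'" "[:1, 1, 1:] dvd q - q'"
  then have "[:1, 1, 1:] dvd (p - p') * q + p' * (q - q')" by (intro dvd_add) auto
  then show "[:1, 1, 1:] dvd p * q - p' * q'" by (simp add: algebra_simps)
qed

instance
proof
  fix a b c :: GR42
  show "a * b * c = a * (b * c)" by transfer (simp add: mult.assoc)
  show "a * b = b * a" by transfer (simp add: mult.commute)
  show "1 * a = a" by transfer simp
  show "a + b + c = a + (b + c)" by transfer (simp add: add.assoc)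
  show "a + b = b + a" by transfer (simp add: add.commute)
  show "0 + a = a" by transfer simp
  show "- a + a = 0" by transfer simp
  show "a - b = a + - b" by transfer simp
  show "(a + b) * c = a * c + b * c" by transfer (simp add: distrib_right)
  show "(0::GR42) \<noteq> 1"
  proof (transfer, rule notI)
    assume "[:1, 1, 1:] dvd (0 :: 4 poly) - 1"
    from eval_alpha_cong[OF this] show False by (simp add: eval_alpha_1)
  qed
qed

end

lift_definition \<xi> :: GR42 is "[:0, 1:]" .

lift_definition \<pi> :: "GR42 \<Rightarrow> F4" is eval_alpha
  by (rule eval_alpha_cong)

text \<open>
  The following facts pin down \<^const>\<open>\<pi>\<close> as the surjective ring homomorphism with kernel
  \<open>2R\<close> that maps \<open>\<xi>\<close> to \<open>\<alpha>\<close>, i.e. the natural epimorphism onto \<open>R/2R\<close>, where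
  \<open>R/2R\<close> is identified with the field of four elements by letting the class of \<open>\<xi>\<close>
  correspond to \<open>\<alpha>\<close>.
\<close>

lemma xi_relation: "\<xi>\<^sup>2 + \<xi> + 1 = 0"
  unfolding power2_eq_square by transfer (simp add: one_pCons)

lemma pi_0: "\<pi> 0 = 0" by transfer simp

lemma pi_1: "\<pi> 1 = 1" by transfer (rule eval_alpha_1)

lemma pi_add: "\<pi> (r + s) = \<pi> r + \<pi> s" by transfer (rule eval_alpha_add)

lemma pi_mult: "\<pi> (r * s) = \<pi> r * \<pi> s" by transfer (rule eval_alpha_mult)

lemma pi_xi: "\<pi> \<xi> = \<alpha>"
  by transfer (simp add: Rep_4_simps)

definition Teich :: "GR42 set" where
  "Teich = {0, 1, \<xi>, \<xi>\<^sup>2}"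

lemma bij_betw_pi_Teich: "bij_betw \<pi> Teich UNIV"
proof -
  have *: "\<pi> (\<xi>\<^sup>2) = \<alpha>\<^sup>2" by (simp add: power2_eq_square pi_mult pi_xi)
  have image: "\<pi> ` Teich = UNIV"
    by (simp add: Teich_def UNIV_F4 pi_0 pi_1 pi_xi *)
  have fin: "finite Teich" by (simp add: Teich_def)
  have "card Teich \<le> 4"
    unfolding Teich_def using card_length[of "[0, 1, \<xi>, \<xi>\<^sup>2]"] by simp
  moreover have "4 \<le> card Teich"
    using card_image_le[OF fin, of \<pi>] by (simp only: image CARD_F4)
  ultimately have "inj_on \<pi> Teich"
    using eq_card_imp_inj_on[OF fin, of \<pi>] by (simp add: image CARD_F4)
  with image show ?thesis by (simp add: bij_betw_def)
qed

lemma GR42_rep: "\<exists>a b :: int. r = of_int a + of_int b * \<xi>"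
proof -
  have of_int: "abs_GR42 [:of_int n:] = of_int n" for n
  proof -
    have nat: "abs_GR42 [:of_nat n:] = of_nat n" for n
    proof (induction n)
      case 0
      show ?case by (simp add: zero_GR42.abs_eq)
    next
      case (Suc n)
      have "abs_GR42 [:of_nat (Suc n):] = abs_GR42 (1 + [:of_nat n:])"
        by (simp add: one_pCons add.commute)
      then show ?case
        by (simp add: plus_GR42.abs_eq[symmetric] one_GR42.abs_eq[symmetric] Suc)
    qed
    show ?thesis
    proof (cases n)
      case (nonneg m)
      then show ?thesis by (simp add: nat)
    next
      case (neg m)
      have "abs_GR42 [:of_int n:] = abs_GR42 (- [:of_nat (Suc m):])"
        using neg by simp
      then show ?thesis using neg
        by (simp only: uminus_GR42.abs_eq[symmetric] nat) simp
    qed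
  qed
  have "\<exists>a b :: int. abs_GR42 p = of_int a + of_int b * \<xi>" for p
  proof (induction p)
    case 0
    have "abs_GR42 0 = of_int 0 + of_int 0 * \<xi>" by (simp add: zero_GR42.abs_eq[symmetric])
    then show ?case by blast
  next
    case (pCons c p)
    then obtain a b where ab: "abs_GR42 p = of_int a + of_int b * \<xi>" by blast
    obtain n where n: "c = of_int n" by (cases c) auto
    have "abs_GR42 (pCons c p) = abs_GR42 ([:c:] + [:0, 1:] * p)" by simp
    also have "\<dots> = of_int n + \<xi> * (of_int a + of_int b * \<xi>)"
      by (simp only: plus_GR42.abs_eq[symmetric] times_GR42.abs_eq[symmetric]
          ab n of_int \<xi>.abs_eq[symmetric])
    also have "\<dots> = of_int n + of_int a * \<xi> + of_int b * \<xi>\<^sup>2"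
      by (simp add: algebra_simps power2_eq_square)
    also have "\<xi>\<^sup>2 = - \<xi> - 1"
    proof -
      have "\<xi>\<^sup>2 = (\<xi>\<^sup>2 + \<xi> + 1) - \<xi> - 1" by simp
      then show ?thesis by (simp only: xi_relation) simp
    qed
    also have "of_int n + of_int a * \<xi> + of_int b * (- \<xi> - 1)
        = of_int (n - b) + of_int (a - b) * \<xi>"
      by (simp add: algebra_simps)
    finally show ?case by blast
  qed
  then show ?thesis by (metis Quotient3_abs_rep Quotient3_GR42)
qed

lemma pi_eq_0_iff: "\<pi> r = 0 \<longleftrightarrow> (\<exists>s. r = 2 * s)"
proof
  assume "\<exists>s. r = 2 * s"
  then obtain s where "r = 2 * s" by blast
  then show "\<pi> r = 0" by (simp only: mult_2 pi_add double_F4)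
next
  assume *: "\<pi> r = 0"
  obtain a b :: int where r: "r = of_int a + of_int b * \<xi>" using GR42_rep by blast
  have nat: "\<pi> (of_nat n) = of_nat n" for n
    by (induction n) (simp_all add: pi_0 pi_1 pi_add)
  have minus: "\<pi> (- x) = - \<pi> x" for x
  proof -
    have "\<pi> x + \<pi> (- x) = 0" by (simp add: pi_add[symmetric] pi_0)
    then show ?thesis by (rule minus_unique[symmetric])
  qed
  have int: "\<pi> (of_int n) = of_int n" for n
  proof (cases n)
    case (nonneg m)
    then show ?thesis by (simp add: nat)
  next
    case (neg m)
    then show ?thesis by (simp only: of_int_minus minus of_int_of_nat_eq nat)
  qed
  have "even a \<and> even b"
    using *[unfolded r pi_add pi_mult pi_xi int]
    by (auto simp: of_int_F4 zero_F4_def one_F4_def split: if_splits)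
  then obtain a' b' where "a = 2 * a'" "b = 2 * b'" by blast
  then have "r = 2 * (of_int a' + of_int b' * \<xi>)" by (simp add: r distrib_left mult.assoc)
  then show "\<exists>s. r = 2 * s" by blast
qed

definition teich :: "F4 \<Rightarrow> GR42" where
  "teich = the_inv_into Teich \<pi>"


section \<open>The sets \<open>D\<^bsub>\<ell>,j,k\<^esub>\<close>\<close>

text \<open>
  Vectors of length \<open>n\<close> over the field with four elements are extensional functions on \<open>{1..n}\<close>.
\<close>

definition F4_space :: "nat \<Rightarrow> (nat \<Rightarrow> F4) set" where
  "F4_space n = (\<Pi>\<^sub>E i\<in>{1..n}. UNIV)"

definition F4_zero :: "nat \<Rightarrow> nat \<Rightarrow> F4" where
  "F4_zero n = (\<lambda>i\<in>{1..n}. 0)"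

definition Q_form :: "nat \<Rightarrow> nat \<Rightarrow> (nat \<Rightarrow> F4) \<Rightarrow> F4" where
  "Q_form l j x =
     (\<Sum>i=1..j. \<alpha> * (x (2*i-1))\<^sup>2 + x (2*i-1) * x (2*i) + (x (2*i))\<^sup>2) +
     (\<Sum>i=j+1..l. x (2*i-1) * x (2*i))"

definition ambient_group :: "nat \<Rightarrow> nat \<Rightarrow> ((nat \<Rightarrow> GR42) \<times> (nat \<Rightarrow> F4)) monoid" where
  "ambient_group l k =
     product_group {1..k} (\<lambda>_. additive_group) \<times>\<times> product_group {1..2*l-2*k} (\<lambda>_. additive_group)"

definition F_map :: "nat \<Rightarrow> nat \<Rightarrow> (nat \<Rightarrow> F4) \<Rightarrow> (nat \<Rightarrow> GR42) \<times> (nat \<Rightarrow> F4)" where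
  "F_map l k x =
     ((\<lambda>i\<in>{1..k}. teich (x (2*i-1)) + 2 * teich (x (2*i))),
      (\<lambda>i\<in>{1..2*l-2*k}. x (2*k+i)))"

definition D_set :: "nat \<Rightarrow> nat \<Rightarrow> nat \<Rightarrow> ((nat \<Rightarrow> GR42) \<times> (nat \<Rightarrow> F4)) set" where
  "D_set l j k = {F_map l k x | x. x \<in> F4_space (2*l) - {F4_zero (2*l)} \<and> Q_form l j x = 0}"

end

theory Submission
  imports Defs
begin

text \<open>
  The bijection \<^const>\<open>F_map\<close> is not additive, but the group law it pulls back to vectors over the
  field with four elements is explicit.  In the Galois ring,
  \<open>teich a + teich b = teich (a + b) + 2 * teich ((a * b)\<^sup>2)\<close> (lemma \<open>teich_add\<close>), so on each of the
  first \<open>k\<close> pairs of coordinates the sum of \<open>(g, h)\<close> and \<open>(u, v)\<close> is \<open>(g + u, h + v + (g * u)\<^sup>2)\<close>,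
  and on the other coordinates it is the usual one.  Write \<open>y \<oplus> x\<close> for this sum and \<open>Q\<close> for the
  quadratic form.  The multiplicity of \<open>y \<noteq> 0\<close> as a difference is, up to the contribution of the zero
  vector, the number \<open>N\<close> of common zeros \<open>x\<close> of \<open>Q x\<close> and \<open>Q (y \<oplus> x)\<close>.  With the nontrivial additive
  character \<open>\<chi>\<close> of the field that is invariant under squaring, \<open>16 N\<close> is the sum of
  \<open>\<chi> (a * Q x + b * Q (y \<oplus> x))\<close> over all \<open>a\<close>, \<open>b\<close> and \<open>x\<close>, and for fixed \<open>a\<close> and \<open>b\<close> the sum over
  \<open>x\<close> is a product of sums over one pair of coordinates.

  These local sums do not notice the carry \<open>(g * u)\<^sup>2\<close>.  On an elliptic plane, the carry changes
  \<open>Q (y \<oplus> x)\<close> by \<open>g\<^sup>2\<close> if \<open>u = g\<close> and not at all otherwise (lemma \<open>block_form_translate\<close>).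
  If \<open>a = b \<noteq> 0\<close>, summation over \<open>v\<close> gives \<open>0\<close> unless \<open>g = 0\<close>, and then the change is \<open>0\<close>.  If \<open>a \<noteq> b\<close>,
  put \<open>c = a + b\<close>; summation over \<open>v\<close> leaves only \<open>u = c + b * g / c\<close>.  This equals \<open>g\<close> only if
  \<open>a * g = c\<^sup>2\<close>, so that \<open>a \<noteq> 0\<close>.  If \<open>b = 0\<close>, the change is multiplied by \<open>0\<close>; if \<open>b \<noteq> 0\<close>, then
  \<open>a\<close>, \<open>b\<close>, \<open>c\<close> are the three nonzero elements, \<open>a * b * c = 1\<close>, hence \<open>g = b\<close>, and the extra factor is
  \<open>\<chi> (b * g\<^sup>2) = \<chi> 1 = 1\<close>.  Here \<open>k \<le> j\<close> ensures that carries occur on elliptic planes only.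

  Consequently all sums are those of the quadratic form on the elementary abelian group: completing
  the square gives \<open>(-1)\<^sup>j * 4\<^sup>l * \<chi> (a * b / (a + b) * Q y)\<close> for \<open>a \<noteq> b\<close>, and the sum for
  \<open>a = b \<noteq> 0\<close> vanishes.  Adding them up yields \<open>N\<close> (lemma \<open>card_common_zeros\<close>); the two points
  \<open>0\<close> and the inverse of \<open>y\<close> have to be removed from the common zeros exactly if \<open>Q y = 0\<close>, which is the
  case in which \<open>y\<close> belongs to the difference set.
\<close>

section \<open>The additive character of the field with four elements\<close>

text \<open>
  The character \<open>x \<mapsto> (-1)\<^bsup>tr x\<^esup>\<close>, where \<open>tr x = x + x\<^sup>2\<close> is the absolute trace; it is real valued,
  so integers suffice as values.
\<close>

definition chi :: "F4 \<Rightarrow> int" where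
  "chi x = (if x = 0 \<or> x = 1 then 1 else -1)"

lemma UNIV_F4_constructors: "(UNIV :: F4 set) = {F4_0, F4_1, F4_alpha, F4_alpha2}"
  using F4.exhaust by blast

lemma chi_constructors: "chi F4_0 = 1" "chi F4_1 = 1" "chi F4_alpha = -1" "chi F4_alpha2 = -1"
  by (simp_all add: chi_def zero_F4_def one_F4_def)

text \<open>
  Rewriting closed expressions with these tables alone decides every identity in the field by cases.
  The general simplification rules for rings would collect \<open>x + x\<close> to \<open>2 * x\<close>, which no table covers.
\<close>

lemmas F4_tables = zero_F4_def one_F4_def minus_F4_def uminus_F4_def power2_eq_square
  divide_F4_def plus_F4.simps times_F4.simps inverse_F4.simps F4.distinct chi_constructors
  simp_thms if_True if_False

lemma add_cancel_F4: "x + (x + y) = (y :: F4)"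
  by (simp add: add.assoc[symmetric] double_F4)

lemma add_eq_0_iff_F4: "x + y = 0 \<longleftrightarrow> x = (y :: F4)"
  by (cases x; cases y; simp only: F4_tables)

lemma two_F4: "(2 :: F4) = 0"
  using double_F4[of 1] by simp

lemma power2_add_F4: "(x + y)\<^sup>2 = x\<^sup>2 + (y\<^sup>2 :: F4)"
  by (cases x; cases y; simp only: F4_tables)

lemma power4_F4: "(c\<^sup>2)\<^sup>2 = (c :: F4)"
  by (cases c; simp only: F4_tables)

lemma chi_0: "chi 0 = 1" by (simp add: chi_def)

lemma chi_add: "chi (x + y) = chi x * chi y"
  by (cases x; cases y; simp only: F4_tables mult_1 mult_1_right mult_minus1 mult_minus1_right minus_minus)

lemma chi_power2: "chi (x\<^sup>2) = chi x"
  by (cases x; simp only: F4_tables)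

lemma chi_sum: "chi (\<Sum>i\<in>I. f i) = (\<Prod>i\<in>I. chi (f i))"
  by (induction I rule: infinite_finite_induct) (simp_all add: chi_0 chi_add)

lemma sum_F4: "(\<Sum>v\<in>UNIV. f v) = f F4_0 + f F4_1 + f F4_alpha + f F4_alpha2"
  by (simp add: UNIV_F4_constructors add.assoc)

lemma sum_chi_linear: "(\<Sum>v\<in>UNIV. chi (d * v)) = (if d = 0 then 4 else 0)"
  unfolding sum_F4 by (cases d; simp only: F4_tables; simp)

text \<open>
  Since \<open>c * v\<^sup>2\<close> is the square of \<open>c\<^sup>2 * v\<close> and the character is invariant under squaring, the
  quadratic term may be replaced by the linear term \<open>c\<^sup>2 * v\<close>.
\<close>

lemma sum_chi_quadratic:
  "(\<Sum>v\<in>UNIV. chi (c * v\<^sup>2 + d * v + K)) = (if d = c\<^sup>2 then 4 * chi K else 0)"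
proof -
  have "chi (c * v\<^sup>2 + d * v + K) = chi ((c\<^sup>2 + d) * v) * chi K" for v
  proof -
    have "chi (c * v\<^sup>2) = chi (c\<^sup>2 * v)"
      by (metis chi_power2 power4_F4 power_mult_distrib)
    then show ?thesis by (simp add: chi_add distrib_right)
  qed
  then have "(\<Sum>v\<in>UNIV. chi (c * v\<^sup>2 + d * v + K)) = (\<Sum>v\<in>UNIV. chi ((c\<^sup>2 + d) * v)) * chi K"
    by (simp add: sum_distrib_right)
  then show ?thesis
    by (auto simp: sum_chi_linear add_eq_0_iff_F4)
qed

section \<open>Character sums over one pair of coordinates\<close>

text \<open>
  Up to equivalence, these are the two nondegenerate quadratic forms on a plane: the elliptic one, with
  no nontrivial zero, and the hyperbolic one.
\<close>

definition block_form :: "bool \<Rightarrow> F4 \<Rightarrow> F4 \<Rightarrow> F4" where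
  "block_form e u v = (if e then \<alpha> * u\<^sup>2 + u * v + v\<^sup>2 else u * v)"

text \<open>
  The flag tells whether the pair of coordinates encodes an element of the Galois ring; the value is
  then the carry from the first to the second Teichmueller digit in an addition.
\<close>

definition carry :: "bool \<Rightarrow> F4 \<Rightarrow> F4 \<Rightarrow> F4" where
  "carry t g u = (if t then (g * u)\<^sup>2 else 0)"

lemma carry_correction: "(g + u) * (g * u)\<^sup>2 + ((g * u)\<^sup>2)\<^sup>2 = (if u = g then g\<^sup>2 else (0 :: F4))"
  by (cases g; cases u; simp only: F4_tables)

text \<open>
  Apart from the last summand, this is the polarization identity.  The carry enters an elliptic plane
  through \<open>u * v + v\<^sup>2\<close>, and \<open>carry_correction\<close> evaluates its effect.
\<close>

lemma block_form_translate:
  assumes "t \<longrightarrow> e"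
  shows "block_form e (g + u) (h + v + carry t g u) =
    block_form e u v + block_form e g h + (u * h + g * v) + (if t \<and> u = g then g\<^sup>2 else 0)"
proof (cases t)
  case True
  have "block_form e (g + u) (h + v + carry t g u) = \<alpha> * (g + u)\<^sup>2 + (g + u) * (h + v) + (h + v)\<^sup>2
      + ((g + u) * (g * u)\<^sup>2 + ((g * u)\<^sup>2)\<^sup>2)"
    using True assms unfolding block_form_def carry_def power2_add_F4[of "h + v"]
    by (simp add: algebra_simps)
  then show ?thesis
    using True assms by (simp only: carry_correction power2_add_F4) (simp add: block_form_def algebra_simps)
next
  case False
  then show ?thesis
    by (simp add: block_form_def carry_def power2_add_F4 algebra_simps)
qed

text \<open>
  The local factor of the character sums below, for the translation by \<open>(g, h)\<close>.
\<close>

definition block_sum :: "bool \<Rightarrow> bool \<Rightarrow> F4 \<Rightarrow> F4 \<Rightarrow> F4 \<Rightarrow> F4 \<Rightarrow> int" where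
  "block_sum t e a b g h =
    (\<Sum>u\<in>UNIV. \<Sum>v\<in>UNIV. chi (a * block_form e u v + b * block_form e (g + u) (h + v + carry t g u)))"

text \<open>
  Without carry, completing the square in \<open>a * q x + b * q (y + x)\<close> gives
  \<open>(a + b) * q (x + b / (a + b) * y) + a * b / (a + b) * q y\<close>, and the sum of \<open>\<chi> (c * q x)\<close> is \<open>-4\<close>
  for the elliptic and \<open>4\<close> for the hyperbolic plane.  A carry makes no difference: only one \<open>u\<close>
  survives the summation over \<open>v\<close>, and if it equals \<open>g\<close> while \<open>a * b \<noteq> 0\<close>, then \<open>g = b\<close> and the correction
  contributes \<open>\<chi> (b * b\<^sup>2) = 1\<close>.
\<close>

lemma block_sum_neq:
  assumes "t \<longrightarrow> e" "a \<noteq> b"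
  shows "block_sum t e a b g h = (if e then - 4 else 4) * chi (a * b / (a + b) * block_form e g h)"
proof -
  define K where "K u = (if e then (a + b) * \<alpha> * u\<^sup>2 else 0)
      + b * (block_form e g h + u * h + (if t \<and> u = g then g\<^sup>2 else 0))" for u
  \<comment> \<open>The condition is the one under which the linear coefficient of \<open>v\<close> cancels the quadratic one.\<close>
  have "(\<Sum>v\<in>UNIV. chi (a * block_form e u v + b * block_form e (g + u) (h + v + carry t g u)))
     = (if (a + b) * u + b * g = (if e then (a + b)\<^sup>2 else 0) then 4 * chi (K u) else 0)" for u
  proof -
    have "a * block_form e u v + b * block_form e (g + u) (h + v + carry t g u)
      = (if e then a + b else 0) * v\<^sup>2 + ((a + b) * u + b * g) * v + K u" for v
      unfolding block_form_translate[OF assms(1)] K_def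
      by (simp add: block_form_def[of e u v] algebra_simps)
    then show ?thesis
      by (simp add: sum_chi_quadratic)
  qed
  then have *: "block_sum t e a b g h =
      (\<Sum>u\<in>UNIV. if (a + b) * u + b * g = (if e then (a + b)\<^sup>2 else 0) then 4 * chi (K u) else 0)"
    by (simp add: block_sum_def)
  \<comment> \<open>A sum of four terms remains, and finitely many values of the parameters.\<close>
  show ?thesis
    using assms unfolding * sum_F4 K_def block_form_def
    by (cases t; cases e; simp only: simp_thms if_True if_False;
        cases a; cases b; cases g; cases h; simp only: F4_tables; simp)
qed

text \<open>
  For \<open>a = b\<close> the quadratic terms cancel, and what remains is a linear character of \<open>v\<close>, nontrivial
  unless \<open>a * g = 0\<close>.  For \<open>g = 0\<close> there is no carry, and a linear character of \<open>u\<close> remains.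
\<close>

lemma block_sum_eq:
  assumes "t \<longrightarrow> e"
  shows "block_sum t e a a g h = (if a = 0 \<or> g = 0 \<and> h = 0 then 16 else 0)"
proof -
  have inner: "(\<Sum>v\<in>UNIV. chi (a * block_form e u v + a * block_form e (g + u) (h + v + carry t g u)))
     = (if a * g = 0 then 4 * chi (a * (block_form e g h + u * h)) else 0)" for u
  proof -
    have "a * block_form e u v + a * block_form e (g + u) (h + v + carry t g u)
      = 0 * v\<^sup>2 + (a * g) * v + a * (block_form e g h + u * h + (if t \<and> u = g then g\<^sup>2 else 0))" for v
      unfolding block_form_translate[OF assms]
      by (simp only: distrib_left add.assoc add_cancel_F4) (simp add: algebra_simps)
    then show ?thesis
      by (simp only: sum_chi_quadratic) (simp add: cong: if_cong)
  qed
  have outer: "(\<Sum>u\<in>UNIV. chi (a * (block_form e g h + u * h)))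
      = (if a * h = 0 then 4 else 0) * chi (a * block_form e g h)"
  proof -
    have "chi (a * (block_form e g h + u * h)) = chi ((a * h) * u) * chi (a * block_form e g h)" for u
      by (simp add: chi_add[symmetric] algebra_simps)
    then show ?thesis
      by (simp only: sum_distrib_right[symmetric] sum_chi_linear)
  qed
  have zero: "block_form e 0 0 = 0" by (simp add: block_form_def)
  show ?thesis
  proof (cases "a * g = 0")
    case True
    then have "block_sum t e a a g h = 4 * ((if a * h = 0 then 4 else 0) * chi (a * block_form e g h))"
      unfolding block_sum_def inner by (simp only: simp_thms if_True sum_distrib_left[symmetric] outer)
    then show ?thesis using True by (auto simp: zero chi_0)
  next
    case False
    then show ?thesis unfolding block_sum_def inner by simp
  qed
qed

section \<open>Arithmetic of the Galois ring\<close>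

text \<open>
  A multiple of a monic polynomial has at least its degree, although the coefficient ring has zero
  divisors.  Hence remainders modulo \<open>x\<^sup>2 + x + 1\<close> are unique, which gives the order of the Galois ring.
\<close>

lemma monic_quadratic_dvd_linear:
  assumes "[:1, 1, 1:] dvd [:a, b :: 4:]"
  shows "a = 0 \<and> b = 0"
proof -
  from assms obtain q where q: "[:a, b:] = [:1, 1, 1:] * q" by (rule dvdE)
  have "q = 0"
  proof (rule ccontr)
    assume "q \<noteq> 0"
    have "coeff [:a, b:] (degree [:1, 1, 1 :: 4:] + degree q) = lead_coeff [:1, 1, 1 :: 4:] * lead_coeff q"
      unfolding q by (rule coeff_mult_degree_sum)
    then show False
      using \<open>q \<noteq> 0\<close> by (simp add: coeff_pCons numeral_2_eq_2)
  qed
  with q show ?thesis by simp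
qed

definition GR42_of_coeffs :: "4 \<Rightarrow> 4 \<Rightarrow> GR42" where
  "GR42_of_coeffs a b = abs_GR42 [:a, b:]"

lemma GR42_of_coeffs_add:
  "GR42_of_coeffs (a + a') (b + b') = GR42_of_coeffs a b + GR42_of_coeffs a' b'"
  by (simp add: GR42_of_coeffs_def plus_GR42.abs_eq)

lemma GR42_of_coeffs_inject:
  "GR42_of_coeffs a b = GR42_of_coeffs a' b' \<longleftrightarrow> a = a' \<and> b = b'"
  using monic_quadratic_dvd_linear[of "a - a'" "b - b'"]
  by (auto simp: GR42_of_coeffs_def GR42.abs_eq_iff)

text \<open>
  Division with remainder by \<open>x\<^sup>2 + x + 1\<close>, by recursion on the coefficients: a remainder
  \<open>c + a x + b x\<^sup>2\<close> is reduced by subtracting \<open>b (x\<^sup>2 + x + 1)\<close>.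
\<close>

lemma GR42_of_coeffs_surj: "\<exists>a b. r = GR42_of_coeffs a b"
proof -
  have "\<exists>a b. [:1, 1, 1:] dvd p - [:a, b :: 4:]" for p
  proof (induction p)
    case 0
    have "[:1, 1, 1:] dvd (0 - [:0, 0:] :: 4 poly)" by simp
    then show ?case by blast
  next
    case (pCons c p)
    then obtain a b where "[:1, 1, 1:] dvd p - [:a, b:]" by blast
    then have "[:1, 1, 1:] dvd [:0, 1:] * (p - [:a, b:]) + smult b [:1, 1, 1:]"
      by (intro dvd_add dvd_mult dvd_smult) auto
    also have "[:0, 1:] * (p - [:a, b:]) + smult b [:1, 1, 1:] = pCons c p - [:c - b, a - b:]"
      by simp
    finally show ?case by blast
  qed
  then show ?thesis
    unfolding GR42_of_coeffs_def by (metis GR42.abs_eq_iff Quotient3_abs_rep Quotient3_GR42)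
qed

lemma card_GR42: "card (UNIV :: GR42 set) = 16"
proof -
  have "bij (case_prod GR42_of_coeffs)"
    using GR42_of_coeffs_surj by (auto simp: bij_def inj_def GR42_of_coeffs_inject surj_def)
  then have "card (UNIV :: GR42 set) = card (UNIV :: (4 \<times> 4) set)"
    by (metis bij_betw_same_card)
  also have "\<dots> = 16"
    by (simp only: card_prod) simp
  finally show ?thesis .
qed

lemma GR42_char: "(4 :: GR42) = 0"
proof -
  have "(1 :: GR42) + (1 + (1 + 1)) = 0"
  proof transfer
    have "(1 :: 4 poly) + (1 + (1 + 1)) - 0 = [:4:]" by (simp add: one_pCons)
    also have "\<dots> = 0" by simp
    finally show "[:1, 1, 1:] dvd (1 :: 4 poly) + (1 + (1 + 1)) - 0"
      by (simp only: dvd_0_right)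
  qed
  moreover have "(4 :: GR42) = 1 + (1 + (1 + 1))" by simp
  ultimately show ?thesis by (simp only:)
qed

lemma pi_teich [simp]: "\<pi> (teich c) = c"
  unfolding teich_def using bij_betw_pi_Teich by (simp add: bij_betw_def f_the_inv_into_f)

lemma teich_in: "teich c \<in> Teich"
  unfolding teich_def using bij_betw_pi_Teich
  by (metis bij_betw_def iso_tuple_UNIV_I subset_refl the_inv_into_into)

lemma teich_pi: "r \<in> Teich \<Longrightarrow> teich (\<pi> r) = r"
  unfolding teich_def using bij_betw_pi_Teich by (simp add: bij_betw_def the_inv_into_f_f)

lemma xi_cubed: "\<xi> * (\<xi> * \<xi>) = 1"
proof -
  have "\<xi> * (\<xi> * \<xi>) - 1 = (\<xi> - 1) * (\<xi>\<^sup>2 + \<xi> + 1)"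
    by (simp add: algebra_simps power2_eq_square)
  then show ?thesis by (simp add: xi_relation)
qed

text \<open>
  The nonzero elements are the powers of \<open>\<xi>\<close>, and \<open>\<xi>\<^sup>3 = 1\<close>.
\<close>

lemma Teich_mult:
  assumes "r \<in> Teich" "s \<in> Teich"
  shows "r * s \<in> Teich"
proof -
  have "\<xi> * (\<xi> * (\<xi> * \<xi>)) = \<xi>"
    by (simp add: xi_cubed)
  with assms show ?thesis
    by (auto simp: Teich_def power2_eq_square mult.assoc xi_cubed)
qed

lemma teich_mult: "teich (a * b) = teich a * teich b"
  using teich_pi[OF Teich_mult[OF teich_in teich_in], of a b] by (simp add: pi_mult)

lemma teich_power2: "teich (a\<^sup>2) = (teich a)\<^sup>2"
  by (simp only: power2_eq_square teich_mult)

lemma teich_decomp: "\<exists>s. r = teich (\<pi> r) + 2 * s"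
proof -
  have "\<pi> (r - teich (\<pi> r)) = 0"
    by (metis diff_add_cancel add_right_cancel add_0 pi_add pi_teich)
  then show ?thesis
    by (metis pi_eq_0_iff add_diff_cancel_left' diff_add_cancel add.commute)
qed

text \<open>
  Multiplication by \<open>2\<close> factors through the residue field because \<open>4 = 0\<close>.
\<close>

lemma two_mult_teich_pi: "2 * r = 2 * teich (\<pi> r)"
proof -
  obtain s where "r = teich (\<pi> r) + 2 * s" using teich_decomp by blast
  then have "2 * r = 2 * teich (\<pi> r) + (2 * 2) * s" by (metis distrib_left mult.assoc)
  then show ?thesis by (simp add: GR42_char)
qed

text \<open>
  The squares \<open>p\<^sup>2\<close> and \<open>q\<^sup>2\<close> of \<open>p = teich (a\<^sup>2)\<close> and \<open>q = teich (b\<^sup>2)\<close> are \<open>teich a\<close> and \<open>teich b\<close>.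
  Squaring forgets multiples of \<open>2\<close> because \<open>(r + 2 s)\<^sup>2 = r\<^sup>2\<close> modulo \<open>4\<close>; therefore \<open>(p + q)\<^sup>2\<close> is the
  Teichmueller representative \<open>teich (a + b)\<close>.  The middle term \<open>2 p q\<close> of
  its expansion is the carry, which changes sides without changing sign because \<open>4 = 0\<close>.
\<close>

lemma teich_add: "teich a + teich b = teich (a + b) + 2 * teich ((a * b)\<^sup>2)"
proof -
  define p q where "p = teich (a\<^sup>2)" and "q = teich (b\<^sup>2)"
  have pq: "p\<^sup>2 = teich a" "q\<^sup>2 = teich b" "p * q = teich ((a * b)\<^sup>2)"
    unfolding p_def q_def teich_power2[symmetric] teich_mult[symmetric]
    by (simp_all only: power4_F4 power_mult_distrib)
  obtain s where s: "p + q = teich (\<pi> (p + q)) + 2 * s" using teich_decomp by blast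
  have "(teich (\<pi> (p + q)) + 2 * s)\<^sup>2 = (teich (\<pi> (p + q)))\<^sup>2 + 4 * (teich (\<pi> (p + q)) * s + s\<^sup>2)"
    by (simp add: power2_eq_square algebra_simps)
  then have "(p + q)\<^sup>2 = (teich (\<pi> (p + q)))\<^sup>2"
    using s by (simp add: GR42_char)
  also have "\<dots> = teich ((\<pi> (p + q))\<^sup>2)"
    by (simp only: teich_power2)
  also have "(\<pi> (p + q))\<^sup>2 = a + b"
    by (simp only: pi_add p_def q_def pi_teich power2_add_F4 power4_F4)
  finally have "teich a + teich b + 2 * teich ((a * b)\<^sup>2) = teich (a + b)"
    using pq by (simp add: power2_sum mult.assoc)
  then have "teich (a + b) + 2 * teich ((a * b)\<^sup>2) = teich a + teich b + 4 * teich ((a * b)\<^sup>2)"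
    by (simp add: algebra_simps flip: mult_2)
  then show ?thesis by (simp add: GR42_char)
qed

lemma teich_pair_add:
  "(teich a + 2 * teich b) + (teich a' + 2 * teich b')
    = teich (a + a') + 2 * teich (b + b' + (a * a')\<^sup>2)"
proof -
  have "2 * teich (b + b' + (a * a')\<^sup>2) = 2 * (teich b + teich b' + teich ((a * a')\<^sup>2))"
    by (subst (2) two_mult_teich_pi) (simp add: pi_add)
  then show ?thesis
    using teich_add[of a a'] by (simp add: algebra_simps)
qed

text \<open>
  Each element of the ring has such an expansion, and there are as many expansions as elements.
\<close>

lemma teich_pair_inject:
  "teich a + 2 * teich b = teich a' + 2 * teich b' \<longleftrightarrow> a = a' \<and> b = b'"
proof -
  define f where "f = (\<lambda>(a, b). teich a + 2 * teich b)"
  have "r \<in> range f" for r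
  proof -
    obtain s where "r = teich (\<pi> r) + 2 * s" using teich_decomp by blast
    then have "r = f (\<pi> r, \<pi> s)" by (simp add: f_def two_mult_teich_pi[symmetric])
    then show ?thesis by blast
  qed
  then have "range f = UNIV" by blast
  then have "card (range f) = card (UNIV :: (F4 \<times> F4) set)"
    by (simp only: card_GR42 card_prod CARD_F4)
  then have "inj f"
    by (intro eq_card_imp_inj_on) auto
  from inj_eq[OF this, of "(a, b)" "(a', b')"] show ?thesis by (simp add: f_def)
qed

section \<open>Character sums and common zeros of the quadratic form\<close>

lemma sum_F4_space_Suc:
  "(\<Sum>x\<in>F4_space (Suc n). f x) = (\<Sum>c\<in>UNIV. \<Sum>x\<in>F4_space n. f (x(Suc n := c)))"
proof -
  have "F4_space (Suc n) = (\<lambda>(c, x). x(Suc n := c)) ` (UNIV \<times> F4_space n)"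
    by (simp add: F4_space_def atLeastAtMostSuc_conv PiE_insert_eq)
  moreover have "inj_on (\<lambda>(c, x). x(Suc n := c)) (UNIV \<times> F4_space n)"
    unfolding F4_space_def by (intro inj_combinator) simp
  ultimately have "(\<Sum>x\<in>F4_space (Suc n). f x)
      = (\<Sum>p\<in>UNIV \<times> F4_space n. f (case p of (c, x) \<Rightarrow> x(Suc n := c)))"
    by (simp add: sum.reindex)
  also have "\<dots> = (\<Sum>(c, x)\<in>UNIV \<times> F4_space n. f (x(Suc n := c)))"
    by (intro sum.cong) auto
  finally show ?thesis by (simp add: sum.cartesian_product)
qed

lemma sum_prod_blocks:
  fixes f :: "nat \<Rightarrow> F4 \<Rightarrow> F4 \<Rightarrow> int"
  shows "(\<Sum>x\<in>F4_space (2 * l). \<Prod>i=1..l. f i (x (2 * i - 1)) (x (2 * i)))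
       = (\<Prod>i=1..l. \<Sum>u\<in>UNIV. \<Sum>v\<in>UNIV. f i u v)"
proof (induction l)
  case 0
  show ?case by (simp add: F4_space_def)
next
  case (Suc l)
  let ?P = "\<lambda>x :: nat \<Rightarrow> F4. \<Prod>i=1..l. f i (x (2 * i - 1)) (x (2 * i))"
  have last: "(\<Prod>i=1..Suc l. f i ((x(Suc (2 * l) := u, Suc (Suc (2 * l)) := v)) (2 * i - 1))
      ((x(Suc (2 * l) := u, Suc (Suc (2 * l)) := v)) (2 * i))) = ?P x * f (Suc l) u v" for x u v
  proof -
    have "(\<Prod>i=1..l. f i ((x(Suc (2 * l) := u, Suc (Suc (2 * l)) := v)) (2 * i - 1))
      ((x(Suc (2 * l) := u, Suc (Suc (2 * l)) := v)) (2 * i))) = ?P x"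
      by (intro prod.cong) auto
    then show ?thesis by (simp del: One_nat_def)
  qed
  have "(\<Sum>x\<in>F4_space (2 * Suc l). \<Prod>i=1..Suc l. f i (x (2 * i - 1)) (x (2 * i)))
      = (\<Sum>v\<in>UNIV. \<Sum>u\<in>UNIV. \<Sum>x\<in>F4_space (2 * l). ?P x * f (Suc l) u v)"
    unfolding mult_Suc_right add_2_eq_Suc sum_F4_space_Suc last ..
  also have "\<dots> = (\<Sum>x\<in>F4_space (2 * l). ?P x) * (\<Sum>v\<in>UNIV. \<Sum>u\<in>UNIV. f (Suc l) u v)"
    by (simp add: sum_distrib_left[symmetric] sum_distrib_right[symmetric])
  also have "\<dots> = (\<Prod>i=1..l. \<Sum>u\<in>UNIV. \<Sum>v\<in>UNIV. f i u v) * (\<Sum>u\<in>UNIV. \<Sum>v\<in>UNIV. f (Suc l) u v)"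
    by (simp only: Suc.IH sum.swap[of "\<lambda>v u. f (Suc l) u v" UNIV UNIV])
  also have "\<dots> = (\<Prod>i=1..Suc l. \<Sum>u\<in>UNIV. \<Sum>v\<in>UNIV. f i u v)"
    by simp
  finally show ?case .
qed

text \<open>
  The addition of the ambient group, pulled back along \<^const>\<open>F_map\<close>: among the first \<open>2 * k\<close> coordinates,
  each one at an even position receives the carry from its predecessor.
\<close>

definition F4_sum :: "nat \<Rightarrow> nat \<Rightarrow> (nat \<Rightarrow> F4) \<Rightarrow> (nat \<Rightarrow> F4) \<Rightarrow> nat \<Rightarrow> F4" where
  "F4_sum l k y x = (\<lambda>n\<in>{1..2 * l}. y n + x n + carry (even n \<and> n \<le> 2 * k) (y (n - 1)) (x (n - 1)))"

lemma Q_form_blocks: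
  assumes "j \<le> l"
  shows "Q_form l j x = (\<Sum>i=1..l. block_form (i \<le> j) (x (2 * i - 1)) (x (2 * i)))"
proof -
  have "{1..l} = {1..j} \<union> {j + 1..l}" using assms by auto
  then have "(\<Sum>i=1..l. block_form (i \<le> j) (x (2 * i - 1)) (x (2 * i)))
     = (\<Sum>i=1..j. block_form (i \<le> j) (x (2 * i - 1)) (x (2 * i)))
     + (\<Sum>i=j+1..l. block_form (i \<le> j) (x (2 * i - 1)) (x (2 * i)))"
    by (simp add: sum.union_disjoint)
  then show ?thesis
    by (simp add: Q_form_def block_form_def)
qed

lemma F4_sum_nth:
  assumes "i \<in> {1..l}"
  shows "F4_sum l k y x (2 * i - 1) = y (2 * i - 1) + x (2 * i - 1)"
    and "F4_sum l k y x (2 * i) = y (2 * i) + x (2 * i) + carry (i \<le> k) (y (2 * i - 1)) (x (2 * i - 1))"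
  using assms by (auto simp: F4_sum_def carry_def)

definition form_char_sum :: "nat \<Rightarrow> nat \<Rightarrow> nat \<Rightarrow> (nat \<Rightarrow> F4) \<Rightarrow> F4 \<Rightarrow> F4 \<Rightarrow> int" where
  "form_char_sum l j k y a b =
    (\<Sum>x\<in>F4_space (2 * l). chi (a * Q_form l j x + b * Q_form l j (F4_sum l k y x)))"

lemma form_char_sum_blocks:
  assumes "j \<le> l"
  shows "form_char_sum l j k y a b
    = (\<Prod>i=1..l. block_sum (i \<le> k) (i \<le> j) a b (y (2 * i - 1)) (y (2 * i)))"
proof -
  have "chi (a * Q_form l j x + b * Q_form l j (F4_sum l k y x)) = (\<Prod>i=1..l.
      chi (a * block_form (i \<le> j) (x (2 * i - 1)) (x (2 * i))
        + b * block_form (i \<le> j) (y (2 * i - 1) + x (2 * i - 1))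
            (y (2 * i) + x (2 * i) + carry (i \<le> k) (y (2 * i - 1)) (x (2 * i - 1)))))" for x
    by (simp add: Q_form_blocks[OF assms] sum_distrib_left sum.distrib[symmetric] chi_sum F4_sum_nth
        del: One_nat_def cong: prod.cong)
  then show ?thesis
    unfolding form_char_sum_def block_sum_def sum_prod_blocks[symmetric] by simp
qed

text \<open>
  The factor \<open>a * b / (a + b)\<close> is the same for all planes, so the values of the form on the single
  planes add up to its value at \<open>y\<close>.
\<close>

lemma form_char_sum_neq:
  assumes "k \<le> j" "j \<le> l" "a \<noteq> b"
  shows "form_char_sum l j k y a b = (- 1) ^ j * 4 ^ l * chi (a * b / (a + b) * Q_form l j y)"
proof -
  have "{1..l} = {1..j} \<union> {j + 1..l}" using assms by auto
  then have "(\<Prod>i=1..l. if i \<le> j then - 4 else 4 :: int)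
     = (\<Prod>i=1..j. if i \<le> j then - 4 else 4) * (\<Prod>i=j+1..l. if i \<le> j then - 4 else 4)"
    by (simp add: prod.union_disjoint)
  also have "\<dots> = (- 4) ^ j * 4 ^ (l - j)" by simp
  also have "\<dots> = (- 1) ^ j * 4 ^ l"
  proof -
    have "(- 4 :: int) ^ j = (- 1) ^ j * 4 ^ j" by (simp flip: power_mult_distrib)
    then show ?thesis using assms by (simp flip: power_add)
  qed
  finally have sign: "(\<Prod>i=1..l. if i \<le> j then - 4 else 4 :: int) = (- 1) ^ j * 4 ^ l" .
  have "form_char_sum l j k y a b = (\<Prod>i=1..l. (if i \<le> j then - 4 else 4)
      * chi (a * b / (a + b) * block_form (i \<le> j) (y (2 * i - 1)) (y (2 * i))))"
    unfolding form_char_sum_blocks[OF assms(2)]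
    using assms by (intro prod.cong block_sum_neq) auto
  then show ?thesis
    by (simp only: prod.distrib sign chi_sum[symmetric] sum_distrib_left[symmetric] Q_form_blocks[OF assms(2)])
qed

text \<open>
  For \<open>a \<noteq> 0\<close>, one plane on which \<open>y\<close> does not vanish suffices to make the product vanish.
\<close>

lemma form_char_sum_eq:
  assumes "k \<le> j" "j \<le> l" "y \<in> F4_space (2 * l)" "y \<noteq> F4_zero (2 * l)"
  shows "form_char_sum l j k y a a = (if a = 0 then 16 ^ l else 0)"
proof -
  have "\<exists>n\<in>{1..2 * l}. y n \<noteq> 0"
  proof (rule ccontr)
    assume "\<not> ?thesis"
    then have "y = F4_zero (2 * l)"
      using assms(3) by (intro ext) (auto simp: F4_space_def F4_zero_def PiE_iff extensional_def)
    with assms(4) show False ..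
  qed
  then obtain n where n: "n \<in> {1..2 * l}" "y n \<noteq> 0" by blast
  have "\<exists>i\<in>{1..l}. y (2 * i - 1) \<noteq> 0 \<or> y (2 * i) \<noteq> 0"
  proof (cases "even n")
    case True
    then obtain i where "n = 2 * i" by blast
    then show ?thesis using n by (intro bexI[of _ i]) auto
  next
    case False
    then obtain i where "n = 2 * i + 1" by (rule oddE)
    then show ?thesis using n by (intro bexI[of _ "Suc i"]) auto
  qed
  then obtain i where i: "i \<in> {1..l}" "y (2 * i - 1) \<noteq> 0 \<or> y (2 * i) \<noteq> 0" by blast
  have "form_char_sum l j k y a a
     = (\<Prod>i=1..l. if a = 0 \<or> y (2 * i - 1) = 0 \<and> y (2 * i) = 0 then 16 else 0)"
    unfolding form_char_sum_blocks[OF assms(2)]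
    using assms by (intro prod.cong block_sum_eq) auto
  then show ?thesis
    using i by (cases "a = 0") (auto intro!: prod_zero)
qed

lemma sum_chi_all: "(\<Sum>a\<in>UNIV. chi (a * r)) = (if r = 0 then 4 else 0)"
  using sum_chi_linear[of r] by (simp add: mult.commute)

lemma finite_F4_space: "finite (F4_space n)"
  by (simp add: F4_space_def finite_PiE)

lemma card_F4_space: "card (F4_space n) = 4 ^ n"
  by (simp add: F4_space_def card_PiE CARD_F4)

lemma card_zeros:
  assumes "j \<le> l"
  shows "4 * int (card {x \<in> F4_space (2 * l). Q_form l j x = 0}) = 16 ^ l + 3 * ((- 1) ^ j * 4 ^ l)"
proof -
  let ?W = "(- 1) ^ j * 4 ^ l :: int"
  have "4 * int (card {x \<in> F4_space (2 * l). Q_form l j x = 0})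
      = (\<Sum>x\<in>F4_space (2 * l). if Q_form l j x = 0 then 4 else 0)"
    by (simp add: sum.If_cases finite_F4_space Int_def)
  also have "\<dots> = (\<Sum>a\<in>UNIV. \<Sum>x\<in>F4_space (2 * l). chi (a * Q_form l j x))"
    by (subst sum.swap) (simp add: sum_chi_all)
  also have "\<dots> = (\<Sum>a\<in>(UNIV :: F4 set). if a = 0 then 16 ^ l else ?W)"
  proof (intro sum.cong refl)
    fix a :: F4
    show "(\<Sum>x\<in>F4_space (2 * l). chi (a * Q_form l j x)) = (if a = 0 then 16 ^ l else ?W)"
    proof (cases "a = 0")
      case True
      have "(4 :: int) ^ (2 * l) = 16 ^ l" by (simp add: power_mult)
      with True show ?thesis by (simp add: chi_0 card_F4_space)
    next
      case False
      from form_char_sum_neq[OF _ assms False, of 0] False show ?thesis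
        by (simp add: form_char_sum_def chi_0)
    qed
  qed
  also have "\<dots> = 16 ^ l + 3 * ?W"
    unfolding sum_F4 by (simp only: F4_tables)
  finally show ?thesis .
qed

text \<open>
  By orthogonality, \<open>16\<close> times the indicator function of the common zeros is the sum of
  \<open>\<chi> (a * Q x + b * Q (y \<oplus> x))\<close> over all \<open>a\<close> and \<open>b\<close>.  The pair \<open>a = b = 0\<close> contributes \<open>16\<^sup>l\<close>.  Among
  the twelve pairs with \<open>a \<noteq> b\<close>, six have \<open>a * b = 0\<close>; on the others, \<open>a * b / (a + b)\<close> takes each nonzero
  value twice.  The sum of \<open>\<chi> (a * b / (a + b) * Q y)\<close> over the twelve is thus \<open>12\<close> if \<open>Q y = 0\<close> and
  \<open>6 - 2 = 4\<close> otherwise.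
\<close>

lemma card_common_zeros:
  assumes "k \<le> j" "j \<le> l" "y \<in> F4_space (2 * l)" "y \<noteq> F4_zero (2 * l)"
  shows "16 * int (card {x \<in> F4_space (2 * l). Q_form l j x = 0 \<and> Q_form l j (F4_sum l k y x) = 0})
    = 16 ^ l + (if Q_form l j y = 0 then 12 else 4) * ((- 1) ^ j * 4 ^ l)"
proof -
  let ?W = "(- 1) ^ j * 4 ^ l :: int" and ?Q = "Q_form l j" and ?t = "F4_sum l k y"
  have "16 * int (card {x \<in> F4_space (2 * l). ?Q x = 0 \<and> ?Q (?t x) = 0})
      = (\<Sum>x\<in>F4_space (2 * l). if ?Q x = 0 \<and> ?Q (?t x) = 0 then 16 else 0)"
    by (simp add: sum.If_cases finite_F4_space Int_def)
  also have "\<dots> = (\<Sum>x\<in>F4_space (2 * l). (\<Sum>a\<in>UNIV. chi (a * ?Q x)) * (\<Sum>b\<in>UNIV. chi (b * ?Q (?t x))))"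
    by (intro sum.cong) (auto simp: sum_chi_all)
  also have "\<dots> = (\<Sum>x\<in>F4_space (2 * l). \<Sum>a\<in>UNIV. \<Sum>b\<in>UNIV. chi (a * ?Q x + b * ?Q (?t x)))"
    by (simp add: chi_add sum_product)
  also have "\<dots> = (\<Sum>a\<in>UNIV. \<Sum>x\<in>F4_space (2 * l). \<Sum>b\<in>UNIV. chi (a * ?Q x + b * ?Q (?t x)))"
    by (rule sum.swap)
  also have "\<dots> = (\<Sum>a\<in>UNIV. \<Sum>b\<in>UNIV. form_char_sum l j k y a b)"
    unfolding form_char_sum_def by (intro sum.cong refl sum.swap)
  also have "\<dots> = (\<Sum>a\<in>UNIV. \<Sum>b\<in>UNIV. if a = b then if a = 0 then 16 ^ l else 0
      else ?W * chi (a * b / (a + b) * ?Q y))"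
    using assms by (intro sum.cong refl) (auto simp: form_char_sum_neq form_char_sum_eq)
  also have "\<dots> = 16 ^ l + (if ?Q y = 0 then 12 else 4) * ?W"
    unfolding sum_F4 by (cases "?Q y"; simp only: F4_tables; simp)
  finally show ?thesis .
qed

section \<open>Transport of the group law to vectors over the field with four elements\<close>

lemma additive_group_simps [simp]:
  "carrier additive_group = UNIV" "x \<otimes>\<^bsub>additive_group\<^esub> y = x + y" "\<one>\<^bsub>additive_group\<^esub> = 0"
  by (simp_all add: additive_group_def)

lemma group_ambient: "group (ambient_group l k)"
  unfolding ambient_group_def by (intro DirProd_group product_group group_additive_group)

lemma carrier_ambient:
  "carrier (ambient_group l k) = (\<Pi>\<^sub>E i\<in>{1..k}. UNIV) \<times> (\<Pi>\<^sub>E i\<in>{1..2 * l - 2 * k}. UNIV)"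
  by (simp add: ambient_group_def)

lemma one_ambient: "\<one>\<^bsub>ambient_group l k\<^esub> = F_map l k (F4_zero (2 * l))" if "k \<le> l"
proof -
  have "teich 0 = 0"
    using teich_pi[of 0] by (simp add: Teich_def pi_0)
  then show ?thesis
    using that by (auto simp: ambient_group_def F_map_def F4_zero_def intro!: restrict_ext)
qed

lemma pairs_inject:
  fixes n m :: nat
  assumes "\<And>u v u' v'. h u v = h u' v' \<Longrightarrow> u = u' \<and> v = v'"
    and "\<And>i. i \<in> {1..n} \<Longrightarrow> h (x (2 * i - 1)) (x (2 * i)) = h (y (2 * i - 1)) (y (2 * i))"
    and "m \<in> {1..2 * n}"
  shows "x m = y m"
proof (cases "even m")
  case True
  then obtain i where "m = 2 * i" by blast
  with assms show ?thesis by force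
next
  case False
  then obtain i where "m = 2 * i + 1" by (rule oddE)
  with assms(1)[OF assms(2)[of "Suc i"]] assms(3) show ?thesis by simp
qed

lemma card_carrier_ambient:
  assumes "k \<le> l"
  shows "card (carrier (ambient_group l k)) = 4 ^ (2 * l)"
proof -
  have "card (carrier (ambient_group l k)) = 16 ^ k * 4 ^ (2 * l - 2 * k)"
    by (simp add: carrier_ambient card_cartesian_product card_PiE card_GR42 CARD_F4)
  also have "(16 :: nat) ^ k = 4 ^ (2 * k)" by (simp add: power_mult)
  finally show ?thesis using assms by (simp flip: power_add)
qed

lemma finite_carrier_ambient: "k \<le> l \<Longrightarrow> finite (carrier (ambient_group l k))"
  by (rule card_ge_0_finite) (simp add: card_carrier_ambient)

lemma bij_betw_F_map:
  assumes "k \<le> l"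
  shows "bij_betw (F_map l k) (F4_space (2 * l)) (carrier (ambient_group l k))"
proof -
  have inj: "inj_on (F_map l k) (F4_space (2 * l))"
  proof (rule inj_onI)
    fix x y
    assume xy: "x \<in> F4_space (2 * l)" "y \<in> F4_space (2 * l)" "F_map l k x = F_map l k y"
    have twisted: "x m = y m" if "m \<in> {1..2 * k}" for m
    proof (rule pairs_inject[where h = "\<lambda>u v. teich u + 2 * teich v", OF _ _ that])
      fix i assume "i \<in> {1..k}"
      then show "teich (x (2 * i - 1)) + 2 * teich (x (2 * i)) = teich (y (2 * i - 1)) + 2 * teich (y (2 * i))"
        using arg_cong[OF xy(3), of "\<lambda>p. fst p i"] by (simp add: F_map_def)
    qed (simp add: teich_pair_inject)
    have straight: "x (2 * k + i) = y (2 * k + i)" if "i \<in> {1..2 * l - 2 * k}" for i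
      using arg_cong[OF xy(3), of "\<lambda>p. snd p i"] that by (simp add: F_map_def)
    show "x = y"
    proof (rule PiE_ext)
      show "x \<in> (\<Pi>\<^sub>E i\<in>{1..2 * l}. UNIV)" "y \<in> (\<Pi>\<^sub>E i\<in>{1..2 * l}. UNIV)"
        using xy by (simp_all add: F4_space_def)
      fix m assume "m \<in> {1..2 * l}"
      then show "x m = y m" using twisted[of m] straight[of "m - 2 * k"] by (cases "m \<le> 2 * k") (auto simp: diff_le_mono)
    qed
  qed
  moreover have "F_map l k ` F4_space (2 * l) \<subseteq> carrier (ambient_group l k)"
    by (auto simp: F_map_def carrier_ambient)
  ultimately show ?thesis
    using card_subset_eq[OF finite_carrier_ambient[OF assms], of "F_map l k ` F4_space (2 * l)"]
    by (simp add: bij_betw_def card_image card_F4_space card_carrier_ambient[OF assms])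
qed

lemma F4_sum_closed: "F4_sum l k y x \<in> F4_space (2 * l)"
  by (simp add: F4_sum_def F4_space_def)

lemma F_map_F4_sum:
  assumes "k \<le> l"
  shows "F_map l k (F4_sum l k y x) = F_map l k y \<otimes>\<^bsub>ambient_group l k\<^esub> F_map l k x"
proof -
  have "teich (F4_sum l k y x (2 * i - 1)) + 2 * teich (F4_sum l k y x (2 * i)) =
     (teich (y (2 * i - 1)) + 2 * teich (y (2 * i))) + (teich (x (2 * i - 1)) + 2 * teich (x (2 * i)))"
    if "i \<in> {1..k}" for i
    using that assms F4_sum_nth[of i l k y x]
    by (simp only: teich_pair_add) (simp add: carry_def)
  moreover have "F4_sum l k y x (2 * k + i) = y (2 * k + i) + x (2 * k + i)"
    if "i \<in> {1..2 * l - 2 * k}" for i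
    using that assms by (auto simp: F4_sum_def carry_def)
  ultimately show ?thesis
    unfolding F_map_def ambient_group_def
    by (auto intro!: restrict_ext)
qed

text \<open>
  The inverse for \<^const>\<open>F4_sum\<close>.  The carry of \<open>y\<close> with itself is the fourth power of a coordinate,
  hence that coordinate.
\<close>

definition F4_neg :: "nat \<Rightarrow> nat \<Rightarrow> (nat \<Rightarrow> F4) \<Rightarrow> nat \<Rightarrow> F4" where
  "F4_neg l k y = (\<lambda>n\<in>{1..2 * l}. y n + (if even n \<and> n \<le> 2 * k then y (n - 1) else 0))"

lemma F4_sum_neg: "F4_sum l k y (F4_neg l k y) = F4_zero (2 * l)"
proof -
  have "y n + F4_neg l k y n + carry (even n \<and> n \<le> 2 * k) (y (n - 1)) (F4_neg l k y (n - 1)) = 0"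
    if n: "n \<in> {1..2 * l}" for n
  proof (cases "even n \<and> n \<le> 2 * k")
    case True
    then have "n - 1 \<in> {1..2 * l}" "odd (n - 1)" using n by auto
    then have "F4_neg l k y (n - 1) = y (n - 1)" "F4_neg l k y n = y n + y (n - 1)"
      using True n by (simp_all add: F4_neg_def)
    then show ?thesis
      using True by (simp add: carry_def power4_F4[unfolded power2_eq_square] power2_eq_square add.assoc add_cancel_F4 double_F4)
  next
    case False
    then show ?thesis using n by (auto simp: carry_def F4_neg_def two_F4)
  qed
  then show ?thesis
    unfolding F4_sum_def F4_zero_def by (intro restrict_ext)
qed

text \<open>
  On an elliptic plane \<open>(u, v) \<mapsto> (u, v + u)\<close> is an isometry, and it is there that inversion differs from
  the identity.
\<close>

lemma Q_form_neg:
  assumes "k \<le> j" "j \<le> l"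
  shows "Q_form l j (F4_neg l k y) = Q_form l j y"
proof -
  have "block_form (i \<le> j) (F4_neg l k y (2 * i - 1)) (F4_neg l k y (2 * i))
      = block_form (i \<le> j) (y (2 * i - 1)) (y (2 * i))" if i: "i \<in> {1..l}" for i
  proof -
    have "F4_neg l k y (2 * i - 1) = y (2 * i - 1)"
      "F4_neg l k y (2 * i) = y (2 * i) + (if i \<le> k then y (2 * i - 1) else 0)"
      using i by (auto simp: F4_neg_def)
    moreover have "u * (v + u) + (v + u)\<^sup>2 = u * v + v\<^sup>2" for u v :: F4
      by (cases u; cases v; simp only: F4_tables)
    ultimately show ?thesis
      using i assms by (auto simp: block_form_def add.assoc)
  qed
  then show ?thesis
    unfolding Q_form_blocks[OF assms(2)] by (intro sum.cong refl)
qed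

lemma F4_sum_zero: "y \<in> F4_space (2 * l) \<Longrightarrow> F4_sum l k y (F4_zero (2 * l)) = y"
proof (rule PiE_ext[where k = "{1..2 * l}" and s = "\<lambda>_. UNIV"])
  assume "y \<in> F4_space (2 * l)"
  then show "y \<in> (\<Pi>\<^sub>E i\<in>{1..2 * l}. UNIV)" by (simp add: F4_space_def)
  show "F4_sum l k y (F4_zero (2 * l)) \<in> (\<Pi>\<^sub>E i\<in>{1..2 * l}. UNIV)"
    using F4_sum_closed by (simp add: F4_space_def)
  show "F4_sum l k y (F4_zero (2 * l)) n = y n" if "n \<in> {1..2 * l}" for n
  proof -
    have "carry (even n \<and> n \<le> 2 * k) (y (n - 1)) (F4_zero (2 * l) (n - 1)) = 0"
      using that by (cases "even n") (auto simp: carry_def F4_zero_def)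
    with that show ?thesis by (simp add: F4_sum_def F4_zero_def)
  qed
qed

lemma Q_form_zero: "j \<le> l \<Longrightarrow> Q_form l j (F4_zero (2 * l)) = 0"
  by (auto simp: Q_form_def F4_zero_def intro!: sum.neutral)

lemma F4_zero_in_space: "F4_zero n \<in> F4_space n"
  by (simp add: F4_zero_def F4_space_def)

lemma F4_neg_in_space: "F4_neg l k y \<in> F4_space (2 * l)"
  by (simp add: F4_neg_def F4_space_def)

lemma F4_sum_eq_zero_iff:
  assumes "k \<le> l" "x \<in> F4_space (2 * l)" "y \<in> F4_space (2 * l)"
  shows "F4_sum l k y x = F4_zero (2 * l) \<longleftrightarrow> x = F4_neg l k y"
proof
  interpret group "ambient_group l k" by (rule group_ambient)
  note bij = bij_betw_F_map[OF assms(1)]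
  assume "F4_sum l k y x = F4_zero (2 * l)"
  then have "F_map l k y \<otimes>\<^bsub>ambient_group l k\<^esub> F_map l k x
      = F_map l k y \<otimes>\<^bsub>ambient_group l k\<^esub> F_map l k (F4_neg l k y)"
    by (simp only: F4_sum_neg flip: F_map_F4_sum[OF assms(1)])
  then have "F_map l k x = F_map l k (F4_neg l k y)"
    using bij_betwE[OF bij] assms F4_neg_in_space by (metis Units_l_cancel Units_eq)
  then show "x = F4_neg l k y"
    using bij_betw_imp_inj_on[OF bij] assms F4_neg_in_space by (meson inj_onD)
qed (simp add: F4_sum_neg)

section \<open>The partial difference sets\<close>

text \<open>
  A pair with quotient \<open>g\<close> is determined by its second member \<open>d\<close>, the first being \<open>g \<otimes> d\<close>.
\<close>

lemma count_difference_multiset: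
  assumes "group G" "finite (carrier G)" "D \<subseteq> carrier G" "g \<in> carrier G" "g \<noteq> \<one>\<^bsub>G\<^esub>"
  shows "count (difference_multiset G D) g = card {d \<in> D. g \<otimes>\<^bsub>G\<^esub> d \<in> D}"
proof -
  interpret group G by fact
  let ?P = "{(d1, d2). d1 \<in> D \<and> d2 \<in> D \<and> d1 \<noteq> d2}"
  have "finite D" using assms by (meson finite_subset)
  then have fin: "finite ?P"
    using finite_subset[of ?P "D \<times> D"] by auto
  let ?quot = "\<lambda>(d1, d2). d1 \<otimes>\<^bsub>G\<^esub> inv\<^bsub>G\<^esub> d2"
  have "count (difference_multiset G D) g = (\<Sum>p | p \<in> ?P \<and> g = ?quot p. count (mset_set ?P) p)"
    by (simp only: difference_multiset_def count_image_mset' finite_set_mset_mset_set[OF fin])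
  also have "\<dots> = (\<Sum>p | p \<in> ?P \<and> g = ?quot p. 1)"
    using fin by (intro sum.cong refl) (auto simp: count_mset_set)
  also have "\<dots> = card {p. p \<in> ?P \<and> g = ?quot p}"
    by simp
  also have "{p. p \<in> ?P \<and> g = ?quot p}
      = (\<lambda>d. (g \<otimes>\<^bsub>G\<^esub> d, d)) ` {d \<in> D. g \<otimes>\<^bsub>G\<^esub> d \<in> D}" (is "?A = ?B")
  proof
    show "?A \<subseteq> ?B"
      using assms(3,4) by (auto simp: image_iff m_assoc subset_iff)
    show "?B \<subseteq> ?A"
      using assms(3-5) by (auto simp: m_assoc subset_iff)
  qed
  also have "card \<dots> = card {d \<in> D. g \<otimes>\<^bsub>G\<^esub> d \<in> D}"
    by (intro card_image) (auto simp: inj_on_def)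
  finally show ?thesis .
qed

text \<open>
  Both parities are treated at once through the sign \<open>s\<close>, whose square is \<open>1\<close>.
\<close>

lemma partial_difference_set_D_set:
  assumes "k \<le> j" "j \<le> l" "1 \<le> l"
  defines "s \<equiv> (- 1) ^ j :: int"
  shows "partial_difference_set (ambient_group l k)
    (4 ^ (2 * l)) ((4 ^ l - s) * (4 ^ (l - 1) + s))
    (4 ^ (2 * l - 2) + 3 * s * 4 ^ (l - 1) - 2) (4 ^ (2 * l - 2) + s * 4 ^ (l - 1)) (D_set l j k)"
proof -
  let ?X = "F4_space (2 * l)" and ?o = "F4_zero (2 * l)" and ?G = "ambient_group l k"
  let ?Q = "Q_form l j" and ?F = "F_map l k" and ?D = "D_set l j k"
  define Z where "Z = {x \<in> ?X. ?Q x = 0}"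
  have kl: "k \<le> l" using assms by simp
  have inj: "inj_on ?F ?X" and img: "?F ` ?X = carrier ?G"
    using bij_betw_F_map[OF kl] by (auto simp: bij_betw_def)
  have o: "?o \<in> Z" by (simp add: Z_def Q_form_zero assms F4_zero_in_space)
  have ZX: "Z \<subseteq> ?X" by (auto simp: Z_def)
  have finZ: "finite Z" using ZX finite_F4_space by (rule finite_subset)
  have D: "?D = ?F ` (Z - {?o})" by (auto simp: D_set_def Z_def)
  have DG: "?D \<subseteq> carrier ?G" unfolding D using img ZX by auto
  have F_in_D: "?F x \<in> ?D \<longleftrightarrow> x \<in> Z \<and> x \<noteq> ?o" if "x \<in> ?X" for x
    unfolding D using inj_on_image_mem_iff[OF inj that, of "Z - {?o}"] ZX by auto
  obtain m where m: "l = Suc m" using assms(3) by (cases l) auto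
  \<comment> \<open>Every parameter is a polynomial in \<open>p\<close> and \<open>s\<close>.\<close>
  define p where "p = (4 :: int) ^ m"
  have powers: "(16 :: int) ^ l = 16 * (p * p)" "(4 :: int) ^ l = 4 * p" "(4 :: int) ^ (l - 1) = p"
    "(4 :: int) ^ (2 * l - 2) = p * p"
    by (simp_all add: m p_def mult_2 power_add flip: power_mult_distrib)
  have s2: "s * s = 1" by (simp add: s_def flip: power_mult_distrib)

  have "4 * int (card Z) = 16 ^ l + 3 * (s * 4 ^ l)"
    unfolding Z_def s_def by (rule card_zeros[OF assms(2)])
  moreover have "card ?D = card Z - 1"
    unfolding D using o finZ ZX by (subst card_image) (auto intro: inj_on_subset[OF inj])
  moreover have "card Z > 0" using o finZ by (auto simp: card_gt_0_iff)
  ultimately have "int (card ?D) = 4 * (p * p) + 3 * (s * p) - 1"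
    by (simp add: powers)
  also have "\<dots> = (4 * p - s) * (p + s)"
    using s2 by (simp add: algebra_simps)
  finally have card_D: "int (card ?D) = (4 ^ l - s) * (4 ^ (l - 1) + s)"
    by (simp only: powers)

  have count: "int (count (difference_multiset ?G ?D) g)
      = (if g \<in> ?D then p * p + 3 * s * p - 2 else p * p + s * p)"
    if g: "g \<in> carrier ?G" "g \<noteq> \<one>\<^bsub>?G\<^esub>" for g
  proof -
    obtain y where y: "y \<in> ?X" "g = ?F y" using g img by auto
    then have "y \<noteq> ?o" using g by (auto simp: one_ambient[OF kl])
    then have gD: "g \<in> ?D \<longleftrightarrow> ?Q y = 0"
      using y F_in_D[of y] by (simp add: Z_def)
    let ?t = "F4_sum l k y" and ?n = "F4_neg l k y"
    define N where "N = {x \<in> ?X. ?Q x = 0 \<and> ?Q (?t x) = 0}"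
    have finN: "finite N" unfolding N_def using finite_F4_space by simp
    have "{d \<in> ?D. g \<otimes>\<^bsub>?G\<^esub> d \<in> ?D} = ?F ` {x \<in> Z - {?o}. ?F (?t x) \<in> ?D}"
      unfolding D y(2) by (auto simp: F_map_F4_sum[OF kl])
    also have "{x \<in> Z - {?o}. ?F (?t x) \<in> ?D} = N - {?o, ?n}"
      using y(1) F_in_D[OF F4_sum_closed] F4_sum_eq_zero_iff[OF kl _ y(1)]
      by (auto simp: Z_def N_def F4_sum_closed)
    finally have "card {d \<in> ?D. g \<otimes>\<^bsub>?G\<^esub> d \<in> ?D} = card (N - {?o, ?n})"
      using card_image[OF inj_on_subset[OF inj, of "N - {?o, ?n}"]] by (auto simp: N_def)
    then have cnt: "count (difference_multiset ?G ?D) g = card (N - {?o, ?n})"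
      using count_difference_multiset[OF group_ambient finite_carrier_ambient[OF kl] DG g] by simp
    have N16: "16 * int (card N) = 16 ^ l + (if ?Q y = 0 then 12 else 4) * (s * 4 ^ l)"
      unfolding N_def s_def by (rule card_common_zeros[OF assms(1,2) y(1) \<open>y \<noteq> ?o\<close>])
    \<comment> \<open>The zero vector and the inverse of \<open>y\<close> correspond to differences that involve the zero vector.\<close>
    have o_N: "?o \<in> N \<longleftrightarrow> ?Q y = 0"
      using assms y by (simp add: N_def F4_zero_in_space Q_form_zero F4_sum_zero)
    have n_N: "?n \<in> N \<longleftrightarrow> ?Q y = 0"
      using assms by (simp add: N_def F4_neg_in_space Q_form_neg F4_sum_neg Q_form_zero)
    have "?n \<noteq> ?o"
      using \<open>y \<noteq> ?o\<close> y F4_sum_zero[of y l k] F4_sum_neg[of l k y] by auto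
    show ?thesis
    proof (cases "?Q y = 0")
      case True
      then have sub: "{?o, ?n} \<subseteq> N" using o_N n_N by simp
      have "card {?o, ?n} = 2" using \<open>?n \<noteq> ?o\<close> by auto
      then have "int (card (N - {?o, ?n})) = int (card N) - 2"
        using card_Diff_subset[OF _ sub] card_mono[OF finN sub] by simp
      then show ?thesis using N16 True by (simp add: cnt gD powers)
    next
      case False
      then have "N - {?o, ?n} = N" using o_N n_N by auto
      then show ?thesis using N16 False by (simp add: cnt gD powers)
    qed
  qed
  have "int (count (difference_multiset ?G ?D) g) = p * p + 3 * s * p - 2"
    if "g \<in> ?D - {\<one>\<^bsub>?G\<^esub>}" for g
    using count[of g] DG that by auto
  moreover have "int (count (difference_multiset ?G ?D) g) = p * p + s * p"
    if "g \<in> carrier ?G - ?D - {\<one>\<^bsub>?G\<^esub>}" for g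
    using count[of g] that by auto
  ultimately show ?thesis
    unfolding partial_difference_set_def powers
    using group_ambient finite_carrier_ambient[OF kl] DG card_D[unfolded powers]
    by (simp add: Coset.order_def card_carrier_ambient[OF kl])
qed

section \<open>The isomorphism type of the ambient group\<close>

text \<open>
  Applied to the ring as the square of the cyclic group of order \<open>4\<close> and to the field as the square of
  the group of order \<open>2\<close>.  Injectivity and the comparison of orders give bijectivity.
\<close>

lemma product_group_pairs_iso:
  fixes n :: nat and h :: "'b::{finite, ab_group_add} \<Rightarrow> 'b \<Rightarrow> 'a::ab_group_add"
  assumes add: "\<And>u v u' v'. h (u + u') (v + v') = h u v + h u' v'"
    and inject: "\<And>u v u' v'. h u v = h u' v' \<Longrightarrow> u = u' \<and> v = v'"
    and card: "CARD('a) = CARD('b) ^ 2"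
  shows "product_group {1..n} (\<lambda>_. additive_group :: 'a monoid)
    \<cong> product_group {1..2 * n} (\<lambda>_. additive_group :: 'b monoid)" (is "?A \<cong> ?B")
proof -
  define f where "f x = (\<lambda>i\<in>{1..n :: nat}. h (x (2 * i - 1)) (x (2 * i)))" for x
  have inj: "inj_on f (carrier ?B)"
  proof (rule inj_onI)
    fix x y assume xy: "x \<in> carrier ?B" "y \<in> carrier ?B" "f x = f y"
    show "x = y"
    proof (rule PiE_ext)
      show "x \<in> (\<Pi>\<^sub>E i\<in>{1..2 * n}. UNIV)" "y \<in> (\<Pi>\<^sub>E i\<in>{1..2 * n}. UNIV)"
        using xy by simp_all
      fix m assume m: "m \<in> {1..2 * n}"
      show "x m = y m"
      proof (rule pairs_inject[where h = h, OF inject _ m])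
        fix i assume "i \<in> {1..n}"
        then show "h (x (2 * i - 1)) (x (2 * i)) = h (y (2 * i - 1)) (y (2 * i))"
          using fun_cong[OF xy(3), of i] by (simp add: f_def)
      qed
    qed
  qed
  have sub: "f ` carrier ?B \<subseteq> carrier ?A" by (auto simp: f_def)
  have cards: "card (carrier ?A) = card (carrier ?B)"
    by (simp add: card_PiE card power_mult)
  have "CARD('a) > 0" by (simp add: card)
  then have "finite (carrier ?A)" by (simp add: finite_PiE card_ge_0_finite)
  then have "f ` carrier ?B = carrier ?A"
    using sub inj cards by (intro card_subset_eq) (simp_all add: card_image)
  moreover have "f \<in> hom ?B ?A"
    using sub by (intro homI) (auto simp: f_def add intro!: restrict_ext)
  ultimately have "f \<in> iso ?B ?A"
    using inj by (simp add: iso_def bij_betw_def)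
  then have "?B \<cong> ?A" by (auto simp: is_iso_def)
  then show ?thesis
    by (rule group.iso_sym[OF product_group[OF group_additive_group]])
qed

definition F4_of_coeffs :: "2 \<Rightarrow> 2 \<Rightarrow> F4" where
  "F4_of_coeffs a b = (if a = 0 then 0 else 1) + (if b = 0 then 0 else \<alpha>)"

lemma cases_2: "a = 0 \<or> a = (1 :: 2)"
proof -
  have "{0, 1} = (UNIV :: 2 set)"
    by (rule card_subset_eq) simp_all
  then show ?thesis by blast
qed

lemma ambient_group_iso:
  "ambient_group l k \<cong>
     product_group {1..2*k} (\<lambda>_. additive_group :: 4 monoid) \<times>\<times>
     product_group {1..4*l-4*k} (\<lambda>_. additive_group :: 2 monoid)"
proof -
  have "product_group {1..k} (\<lambda>_. additive_group :: GR42 monoid)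
      \<cong> product_group {1..2 * k} (\<lambda>_. additive_group :: 4 monoid)"
    by (rule product_group_pairs_iso[of GR42_of_coeffs])
      (simp_all add: GR42_of_coeffs_add GR42_of_coeffs_inject card_GR42)
  moreover have "product_group {1..2 * l - 2 * k} (\<lambda>_. additive_group :: F4 monoid)
      \<cong> product_group {1..2 * (2 * l - 2 * k)} (\<lambda>_. additive_group :: 2 monoid)"
  proof (rule product_group_pairs_iso[of F4_of_coeffs])
    fix u v u' v' :: 2
    show "F4_of_coeffs (u + u') (v + v') = F4_of_coeffs u v + F4_of_coeffs u' v'"
      using cases_2[of u] cases_2[of v] cases_2[of u'] cases_2[of v']
      by (auto simp: F4_of_coeffs_def two_F4 zero_F4_def one_F4_def)
    show "u = u' \<and> v = v'" if "F4_of_coeffs u v = F4_of_coeffs u' v'"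
      using that cases_2[of u] cases_2[of v] cases_2[of u'] cases_2[of v']
      by (auto simp: F4_of_coeffs_def zero_F4_def one_F4_def)
  qed (simp add: CARD_F4)
  moreover have "2 * (2 * l - 2 * k) = 4 * l - 4 * k" by simp
  ultimately show ?thesis
    unfolding ambient_group_def
    by (intro group.DirProd_iso_trans product_group group_additive_group) (simp_all only:)
qed

section \<open>The parameters for both parities\<close>

theorem theorem2p1:
  fixes j k l :: nat
  assumes "1 \<le> k" and "k \<le> j" and "j \<le> l"
  shows
    "(odd j \<longrightarrow>
        partial_difference_set (ambient_group l k)
          (4^(2*l)) ((4^l + 1) * (4^(l-1) - 1))
          (4^(2*l-2) - 3 * 4^(l-1) - 2) (4^(2*l-2) - 4^(l-1)) (D_set l j k)) \<and>
     (even j \<longrightarrow>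
        partial_difference_set (ambient_group l k)
          (4^(2*l)) ((4^l - 1) * (4^(l-1) + 1))
          (4^(2*l-2) + 3 * 4^(l-1) - 2) (4^(2*l-2) + 4^(l-1)) (D_set l j k)) \<and>
     ambient_group l k \<cong>
       product_group {1..2*k} (\<lambda>_. additive_group :: 4 monoid) \<times>\<times>
       product_group {1..4*l-4*k} (\<lambda>_. additive_group :: 2 monoid)"
proof (intro conjI impI)
  have l: "1 \<le> l" using assms by simp
  note pds = partial_difference_set_D_set[OF assms(2,3) l]
  show "partial_difference_set (ambient_group l k)
      (4^(2*l)) ((4^l + 1) * (4^(l-1) - 1))
      (4^(2*l-2) - 3 * 4^(l-1) - 2) (4^(2*l-2) - 4^(l-1)) (D_set l j k)" if "odd j"
  proof -
    have "(- 1 :: int) ^ j = - 1" using that by simp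
    from pds[unfolded this] show ?thesis by simp
  qed
  show "partial_difference_set (ambient_group l k)
      (4^(2*l)) ((4^l - 1) * (4^(l-1) + 1))
      (4^(2*l-2) + 3 * 4^(l-1) - 2) (4^(2*l-2) + 4^(l-1)) (D_set l j k)" if "even j"
  proof -
    have "(- 1 :: int) ^ j = 1" using that by simp
    from pds[unfolded this] show ?thesis by simp
  qed
qed (rule ambient_group_iso)

end
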